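(* Let $S$ be a semigroup. Functions $f,g,h:S\to\mathbb{C}$ satisfy $$f(xy)=f(x)g(y)+g(x)f(y)+h(x)h(y),\quad x,y\in S,$$ with $f$ and $h$ linearly independent, if and only if there exist a constant $\delta\in\mathbb{C}$ and functions $F,G,H:S\to\mathbb{C}$ such that $$f=F,\qquad g=-\tfrac{\delta^2}{2}F+G+\delta H,\qquad h=-\delta F+H,$$ where $(F,G,H)$ belongs to one of the following families: (1) $F=\psi$, $G=\chi$, $H=\varphi$, where $\chi:S\to\mathbb{C}$ is a multiplicative function and $\psi,\varphi:S\to\mathbb{C}$ are non-zero functions such that $\varphi(xy)=\varphi(x)\chi(y)+\chi(x)\varphi(y)$ and $\psi(xy)=\psi(x)\chi(y)+\chi(x)\psi(y)+\varphi(x)\varphi(y)$ for all $x,y\in S$. (2) $F=c^2\mu-c^2\chi-c\,\varphi$, $G=\chi$, $H=c\,\mu-c\,\chi$, where $c\in\mathbb{C}\setminus\{0\}$ is a constant, $\chi,\mu:S\to\mathbb{C}$ are two multiplicative functions with $\chi\neq\mu$, and $\varphi:S\to\mathbb{C}$ is a non-zero function such that $\varphi(xy)=\varphi(x)\chi(y)+\chi(x)\varphi(y)$ for all $x,y\in S$. (3) $F=-c_1\mu+c_1\chi-c_1c_2\varphi$, $G=\frac12\mu+\frac12\chi-\frac12c_2\varphi$, $H=\varphi$, where $c_1,c_2\in\mathbb{C}\setminus\{0\}$ are constants satisfying $1+c_1c_2^2=0$, $\chi,\mu:S\to\mathbb{C}$ are two multiplicative functions with $\chi\neq\mu$, and $\varphi:S\to\mathbb{C}$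 is a non-zero function such that $\varphi(xy)=\varphi(x)\chi(y)+\chi(x)\varphi(y)$ for all $x,y\in S$. (4) $F=c\rho\,\chi_1+c(2-\rho)\,\chi_2-2c\,\chi_3$, $G=\frac14\rho\,\chi_1+\frac14(2-\rho)\,\chi_2+\frac12\chi_3$, $H=\frac{1}{2\lambda}\chi_1-\frac{1}{2\lambda}\chi_2$, where $\lambda,\rho,c\in\mathbb{C}\setminus\{0\}$ are constants with $2c\lambda^2\rho(2-\rho)=1$, and $\chi_1,\chi_2,\chi_3:S\to\mathbb{C}$ are three multiplicative functions with $\chi_1\neq\chi_2$, $\chi_1\neq\chi_3$, $\chi_2\neq\chi_3$.
   Context: A semigroup is a set with an associative composition. A multiplicative function on $S$ is a function $\chi:S\to\mathbb{C}$ with $\chi(xy)=\chi(x)\chi(y)$ for all $x,y\in S$; the zero function is allowed. A function is non-zero if it is not identically zero. Linear independence is over $\mathbb{C}$ in the vector space of functions $S\to\mathbb{C}$. *)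

theory Defs
  imports Complex_Main "HOL-Library.Function_Algebras"
begin

abbreviation (input) scale_fun :: "complex \<Rightarrow> ('a \<Rightarrow> complex) \<Rightarrow> ('a \<Rightarrow> complex)" where
  "scale_fun \<equiv> (\<lambda>c f x. c * f x)"

lemma module_scale_fun: "module scale_fun"
  by unfold_locales (simp_all add: fun_eq_iff algebra_simps)

text \<open>
  Linear independence in the library is a property of sets, so independence of \<open>{f, h}\<close>
  alone would accept \<open>f = h \<noteq> 0\<close>; independence of the pair needs \<open>f \<noteq> h\<close> in addition.
\<close>

definition lin_indep_pair :: "('a \<Rightarrow> complex) \<Rightarrow> ('a \<Rightarrow> complex) \<Rightarrow> bool" where
  "lin_indep_pair f h \<longleftrightarrow> f \<noteq> h \<and> \<not> module.dependent scale_fun {f, h}"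

lemma lin_indep_pair_iff:
  "lin_indep_pair f h \<longleftrightarrow>
    (\<forall>a b. (\<forall>x. a * f x + b * h x = 0) \<longrightarrow> a = 0 \<and> b = 0)" (is "_ \<longleftrightarrow> ?R")
proof (cases "f = h")
  case True
  have "\<forall>x. 1 * f x + (- 1) * h x = 0"
    using True by simp
  moreover have "(1::complex) \<noteq> 0"
    by simp
  ultimately have "\<not> ?R"
    by blast
  then show ?thesis
    using True unfolding lin_indep_pair_def by blast
next
  case False
  have "module.dependent scale_fun {f, h} \<longleftrightarrow>
      (\<exists>u. (\<exists>v\<in>{f, h}. u v \<noteq> 0) \<and> (\<Sum>v\<in>{f, h}. scale_fun (u v) v) = 0)"
    by (rule module.dependent_finite[OF module_scale_fun]) simp
  also have "\<dots> \<longleftrightarrow> (\<exists>u. (u f \<noteq> 0 \<or> u h \<noteq> 0) \<and> (\<forall>x. u f * f x + u h * h x = 0))"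
    using False by (simp add: fun_eq_iff)
  also have "\<dots> \<longleftrightarrow> (\<exists>a b. (a \<noteq> 0 \<or> b \<noteq> 0) \<and> (\<forall>x. a * f x + b * h x = 0))"
  proof
    assume "\<exists>a b. (a \<noteq> 0 \<or> b \<noteq> 0) \<and> (\<forall>x. a * f x + b * h x = 0)"
    then obtain a b where ab: "a \<noteq> 0 \<or> b \<noteq> 0" "\<forall>x. a * f x + b * h x = 0"
      by blast
    define u where "u = (\<lambda>k. if k = f then a else b)"
    have "u f = a" "u h = b"
      using False by (simp_all add: u_def)
    with ab have "(u f \<noteq> 0 \<or> u h \<noteq> 0) \<and> (\<forall>x. u f * f x + u h * h x = 0)"
      by simp
    then show "\<exists>u. (u f \<noteq> 0 \<or> u h \<noteq> 0) \<and> (\<forall>x. u f * f x + u h * h x = 0)"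
      by (rule exI[of _ u])
  qed blast
  finally show ?thesis
    using False unfolding lin_indep_pair_def by blast
qed

definition multiplicative_fun :: "('a::semigroup_mult \<Rightarrow> complex) \<Rightarrow> bool" where
  "multiplicative_fun \<chi> \<longleftrightarrow> (\<forall>x y. \<chi> (x * y) = \<chi> x * \<chi> y)"

definition sine_addition :: "('a::semigroup_mult \<Rightarrow> complex) \<Rightarrow> ('a \<Rightarrow> complex) \<Rightarrow> bool" where
  "sine_addition \<phi> \<chi> \<longleftrightarrow> (\<forall>x y. \<phi> (x * y) = \<phi> x * \<chi> y + \<chi> x * \<phi> y)"

definition cosine_sine ::
  "('a::semigroup_mult \<Rightarrow> complex) \<Rightarrow> ('a \<Rightarrow> complex) \<Rightarrow> ('a \<Rightarrow> complex) \<Rightarrow> bool" where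
  "cosine_sine f g h \<longleftrightarrow> (\<forall>x y. f (x * y) = f x * g y + g x * f y + h x * h y)"

definition family1 ::
  "('a::semigroup_mult \<Rightarrow> complex) \<Rightarrow> ('a \<Rightarrow> complex) \<Rightarrow> ('a \<Rightarrow> complex) \<Rightarrow> bool" where
  "family1 F G H \<longleftrightarrow> (\<exists>\<chi> \<psi> \<phi>.
     multiplicative_fun \<chi> \<and> \<psi> \<noteq> (\<lambda>x. 0) \<and> \<phi> \<noteq> (\<lambda>x. 0) \<and>
     sine_addition \<phi> \<chi> \<and> cosine_sine \<psi> \<chi> \<phi> \<and>
     F = \<psi> \<and> G = \<chi> \<and> H = \<phi>)"

definition family2 ::
  "('a::semigroup_mult \<Rightarrow> complex) \<Rightarrow> ('a \<Rightarrow> complex) \<Rightarrow> ('a \<Rightarrow> complex) \<Rightarrow> bool" where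
  "family2 F G H \<longleftrightarrow> (\<exists>c \<chi> \<mu> \<phi>.
     c \<noteq> 0 \<and> multiplicative_fun \<chi> \<and> multiplicative_fun \<mu> \<and> \<chi> \<noteq> \<mu> \<and>
     \<phi> \<noteq> (\<lambda>x. 0) \<and> sine_addition \<phi> \<chi> \<and>
     F = (\<lambda>x. c^2 * \<mu> x - c^2 * \<chi> x - c * \<phi> x) \<and>
     G = \<chi> \<and>
     H = (\<lambda>x. c * \<mu> x - c * \<chi> x))"

definition family3 ::
  "('a::semigroup_mult \<Rightarrow> complex) \<Rightarrow> ('a \<Rightarrow> complex) \<Rightarrow> ('a \<Rightarrow> complex) \<Rightarrow> bool" where
  "family3 F G H \<longleftrightarrow> (\<exists>c\<^sub>1 c\<^sub>2 \<chi> \<mu> \<phi>.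
     c\<^sub>1 \<noteq> 0 \<and> c\<^sub>2 \<noteq> 0 \<and> 1 + c\<^sub>1 * c\<^sub>2^2 = 0 \<and>
     multiplicative_fun \<chi> \<and> multiplicative_fun \<mu> \<and> \<chi> \<noteq> \<mu> \<and>
     \<phi> \<noteq> (\<lambda>x. 0) \<and> sine_addition \<phi> \<chi> \<and>
     F = (\<lambda>x. - c\<^sub>1 * \<mu> x + c\<^sub>1 * \<chi> x - c\<^sub>1 * c\<^sub>2 * \<phi> x) \<and>
     G = (\<lambda>x. 1/2 * \<mu> x + 1/2 * \<chi> x - 1/2 * c\<^sub>2 * \<phi> x) \<and>
     H = \<phi>)"

definition family4 ::
  "('a::semigroup_mult \<Rightarrow> complex) \<Rightarrow> ('a \<Rightarrow> complex) \<Rightarrow> ('a \<Rightarrow> complex) \<Rightarrow> bool" where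
  "family4 F G H \<longleftrightarrow> (\<exists>lam rho c \<chi>\<^sub>1 \<chi>\<^sub>2 \<chi>\<^sub>3.
     lam \<noteq> 0 \<and> rho \<noteq> 0 \<and> c \<noteq> 0 \<and> 2 * c * lam^2 * rho * (2 - rho) = 1 \<and>
     multiplicative_fun \<chi>\<^sub>1 \<and> multiplicative_fun \<chi>\<^sub>2 \<and> multiplicative_fun \<chi>\<^sub>3 \<and>
     \<chi>\<^sub>1 \<noteq> \<chi>\<^sub>2 \<and> \<chi>\<^sub>1 \<noteq> \<chi>\<^sub>3 \<and> \<chi>\<^sub>2 \<noteq> \<chi>\<^sub>3 \<and>
     F = (\<lambda>x. c * rho * \<chi>\<^sub>1 x + c * (2 - rho) * \<chi>\<^sub>2 x - 2 * c * \<chi>\<^sub>3 x) \<and>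
     G = (\<lambda>x. 1/4 * rho * \<chi>\<^sub>1 x + 1/4 * (2 - rho) * \<chi>\<^sub>2 x + 1/2 * \<chi>\<^sub>3 x) \<and>
     H = (\<lambda>x. 1 / (2 * lam) * \<chi>\<^sub>1 x - 1 / (2 * lam) * \<chi>\<^sub>2 x))"

end

theory Submission
  imports Defs "HOL-Computational_Algebra.Fundamental_Theorem_Algebra"
begin

text \<open>
  Associativity of the product, applied to \<open>f (x y z)\<close>, forces \<open>g (x y)\<close> and \<open>h (x y)\<close> to be
  symmetric quadratic expressions in \<open>f, g, h\<close> whose coefficients are determined by three numbers
  \<open>B, C, D\<close>. A combination \<open>g + s f + t h\<close> is then multiplicative if and only if
  \<open>t^3 - D t^2 - 2 C t - B = 0\<close> and \<open>s = t^2 - D t - C\<close>. Three distinct roots give three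
  multiplicative functions and family (4), a double root gives family (2), and a triple root
  family (1). Family (3) is a reparametrisation that the forward direction never needs.
\<close>

section \<open>Comparing coefficients over an independent pair of functions\<close>

lemma lin_indep_pairD:
  assumes "lin_indep_pair f h" and "\<And>x. a * f x + b * h x = a' * f x + b' * h x"
  shows "a = a'" "b = b'"
proof -
  have "\<forall>x. (a - a') * f x + (b - b') * h x = 0"
    using assms(2) by (simp add: algebra_simps)
  then have "a - a' = 0 \<and> b - b' = 0"
    using assms(1) unfolding lin_indep_pair_iff by blast
  then show "a = a'" "b = b'"
    by simp_all
qed

text \<open>Independence is used twice: first in \<open>y\<close>, with coefficients that depend on
  \<open>z\<close>, and then in \<open>z\<close>.\<close>

lemma lin_indep_pair_bilinearD:
  assumes "lin_indep_pair f h"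
    and "\<And>y z. a * f z * f y + b * f z * h y + c * h z * f y + d * h z * h y
      = a' * f z * f y + b' * f z * h y + c' * h z * f y + d' * h z * h y"
  shows "a = a'" "b = b'" "c = c'" "d = d'"
proof -
  have *: "a * f z + c * h z = a' * f z + c' * h z" "b * f z + d * h z = b' * f z + d' * h z" for z
  proof -
    have "(a * f z + c * h z) * f y + (b * f z + d * h z) * h y
        = (a' * f z + c' * h z) * f y + (b' * f z + d' * h z) * h y" for y
      using assms(2)[of z y] by (simp add: algebra_simps)
    then show "a * f z + c * h z = a' * f z + c' * h z" "b * f z + d * h z = b' * f z + d' * h z"
      using lin_indep_pairD[OF assms(1)] by blast+
  qed
  show "a = a'" "c = c'" "b = b'" "d = d'"
    using lin_indep_pairD[OF assms(1) *(1)] lin_indep_pairD[OF assms(1) *(2)] by blast+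
qed

lemma lin_indep_pair_shift:
  assumes "lin_indep_pair f h"
  shows "lin_indep_pair f (\<lambda>x. a * f x + h x)"
  unfolding lin_indep_pair_iff
proof (intro allI impI)
  fix u v assume "\<forall>x. u * f x + v * (a * f x + h x) = 0"
  then have "\<forall>x. (u + v * a) * f x + v * h x = 0"
    by (simp add: algebra_simps)
  then have "u + v * a = 0 \<and> v = 0"
    using assms unfolding lin_indep_pair_iff by blast
  then show "u = 0 \<and> v = 0"
    by auto
qed

text \<open>If all these 2x2 minors vanished, the values of \<open>f\<close> and \<open>h\<close> at
  a point where they are not both zero would give the coefficients of a nontrivial relation.\<close>

lemma lin_indep_pair_minor:
  assumes "lin_indep_pair f h"
  obtains p q where "f p * h q - f q * h p \<noteq> 0"
proof -
  have False if *: "\<And>p q. f p * h q - f q * h p = 0"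
  proof -
    obtain p where p: "f p \<noteq> 0 \<or> h p \<noteq> 0"
      using assms unfolding lin_indep_pair_iff by (metis add_0 mult_zero_right zero_neq_one)
    have "\<forall>x. (- h p) * f x + f p * h x = 0"
      using *[of p] by (simp add: algebra_simps)
    then have "- h p = 0 \<and> f p = 0"
      using assms unfolding lin_indep_pair_iff by blast
    with p show False
      by simp
  qed
  then show thesis
    using that by blast
qed

text \<open>Cramer's rule: at two points with nonzero minor the hypothesis is an invertible linear
  system for \<open>u\<close> and \<open>v\<close> whose right-hand sides lie in the span of
  \<open>f\<close> and \<open>h\<close>.\<close>

lemma lin_indep_pair_span:
  assumes "lin_indep_pair f h"
    and "\<And>z. \<exists>a b. \<forall>x. f z * u x + h z * v x = a * f x + b * h x"
  shows "\<exists>a b. \<forall>x. u x = a * f x + b * h x" "\<exists>a b. \<forall>x. v x = a * f x + b * h x"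
proof -
  obtain p q where d: "f p * h q - f q * h p \<noteq> 0" (is "?d \<noteq> 0")
    using lin_indep_pair_minor[OF assms(1)] .
  obtain a b where ab: "\<And>x. f p * u x + h p * v x = a * f x + b * h x"
    using assms(2) by blast
  obtain a' b' where ab': "\<And>x. f q * u x + h q * v x = a' * f x + b' * h x"
    using assms(2) by blast
  have "?d * u x = (h q * a - h p * a') * f x + (h q * b - h p * b') * h x" for x
    using ab[of x] ab'[of x] by algebra
  then have "u x = (h q * a - h p * a') / ?d * f x + (h q * b - h p * b') / ?d * h x" for x
    using d by (metis (no_types, lifting) add_divide_distrib nonzero_mult_div_cancel_left
        times_divide_eq_left)
  then show "\<exists>a b. \<forall>x. u x = a * f x + b * h x"
    by blast
  have "?d * v x = (f p * a' - f q * a) * f x + (f p * b' - f q * b) * h x" for x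
    using ab[of x] ab'[of x] by algebra
  then have "v x = (f p * a' - f q * a) / ?d * f x + (f p * b' - f q * b) / ?d * h x" for x
    using d by (metis (no_types, lifting) add_divide_distrib nonzero_mult_div_cancel_left
        times_divide_eq_left)
  then show "\<exists>a b. \<forall>x. v x = a * f x + b * h x"
    by blast
qed

section \<open>Invariance of the equation and product formulas for \<open>g\<close> and
  \<open>h\<close>\<close>

text \<open>The terms \<delta>^2 \<open>f x * f y\<close> and the cross terms of \<open>f\<close>
  and \<open>H\<close> that come from the new \<open>g\<close> are cancelled by those of the product
  of the new \<open>h\<close> with itself. Hence the families need checking only for
  \<open>(F, G, H)\<close>.\<close>

lemma cosine_sine_shift:
  "cosine_sine f (\<lambda>x. - (\<delta>^2 / 2) * f x + G x + \<delta> * H x) (\<lambda>x. - \<delta> * f x + H x)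
    \<longleftrightarrow> cosine_sine f G H"
  unfolding cosine_sine_def by (simp add: algebra_simps power2_eq_square)

text \<open>This compares the two bracketings of \<open>f (x * y * z)\<close>. It relates the defect
  of \<open>g\<close> from multiplicativity and the defect of \<open>h\<close> from the sine
  addition law, with \<open>z\<close> separated out on the left and \<open>x\<close> on the
  right.\<close>

lemma cosine_sine_cocycle:
  assumes "cosine_sine f g h"
  shows "f z * (g (x * y) - g x * g y) + h z * (h (x * y) - g x * h y - h x * g y)
    = f x * (g (y * z) - g y * g z) + h x * (h (y * z) - g y * h z - h y * g z)"
proof -
  have *: "f (x * y) = f x * g y + g x * f y + h x * h y" for x y
    using assms unfolding cosine_sine_def by blast
  have "f (x * y) * g z + g (x * y) * f z + h (x * y) * h z
      = f x * g (y * z) + g x * f (y * z) + h x * h (y * z)"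
    using *[of "x * y" z] *[of x "y * z"] by (simp add: mult.assoc)
  then show ?thesis
    unfolding *[of x y] *[of y z] by (simp add: algebra_simps)
qed

text \<open>For fixed \<open>y\<close> and \<open>z\<close> the right side of the cocycle identity
  lies in the span of \<open>f\<close> and \<open>h\<close> as a function of \<open>x\<close>;
  varying \<open>z\<close> puts both defects into that span. Their coefficients, as functions of
  \<open>y\<close>, satisfy relations of the same kind and lie in the span too. Only finitely many
  numbers remain to be compared.\<close>

lemma cosine_sine_quadratic:
  assumes fgh: "cosine_sine f g h" and ind: "lin_indep_pair f h"
  obtains B C D where
    "\<And>x y. h (x * y) = g x * h y + h x * g y
      + B * f x * f y + C * (f x * h y + h x * f y) + D * h x * h y"
    "\<And>x y. g (x * y) = g x * g y
      + (C^2 - D * B) * f x * f y + B * (f x * h y + h x * f y) + C * h x * h y"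
proof -
  define \<Gamma> where "\<Gamma> = (\<lambda>x y. g (x * y) - g x * g y)"
  define E where "E = (\<lambda>x y. h (x * y) - g x * h y - h x * g y)"
  have cocycle: "f z * \<Gamma> x y + h z * E x y = f x * \<Gamma> y z + h x * E y z" for x y z
    using cosine_sine_cocycle[OF fgh] unfolding \<Gamma>_def E_def .
  have "\<exists>a b. \<forall>x. \<Gamma> x y = a * f x + b * h x" "\<exists>a b. \<forall>x. E x y = a * f x + b * h x" for y
  proof -
    have "\<exists>a b. \<forall>x. f z * \<Gamma> x y + h z * E x y = a * f x + b * h x" for z
      using cocycle[of z _ y] by (metis mult.commute)
    then show "\<exists>a b. \<forall>x. \<Gamma> x y = a * f x + b * h x" "\<exists>a b. \<forall>x. E x y = a * f x + b * h x"
      using lin_indep_pair_span[OF ind, of "\<lambda>x. \<Gamma> x y" "\<lambda>x. E x y"] by blast+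
  qed
  then obtain a b c d where
    \<Gamma>: "\<And>x y. \<Gamma> x y = a y * f x + b y * h x" and E: "\<And>x y. E x y = c y * f x + d y * h x"
    by metis
  have swap: "f z * a y + h z * c y = a z * f y + b z * h y"
    "f z * b y + h z * d y = c z * f y + d z * h y" for y z
  proof -
    have "(f z * a y + h z * c y) * f x + (f z * b y + h z * d y) * h x
        = (a z * f y + b z * h y) * f x + (c z * f y + d z * h y) * h x" for x
      using cocycle[of z x y] unfolding \<Gamma> E by (simp add: algebra_simps)
    then show "f z * a y + h z * c y = a z * f y + b z * h y"
      "f z * b y + h z * d y = c z * f y + d z * h y"
      using lin_indep_pairD[OF ind] by blast+
  qed
  obtain a1 a2 c1 c2 where a: "\<And>y. a y = a1 * f y + a2 * h y"
    and c: "\<And>y. c y = c1 * f y + c2 * h y"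
    using lin_indep_pair_span[OF ind, of a c] swap(1) by metis
  obtain b1 b2 d1 d2 where b: "\<And>y. b y = b1 * f y + b2 * h y"
    and d: "\<And>y. d y = d1 * f y + d2 * h y"
    using lin_indep_pair_span[OF ind, of b d] swap(2) by metis
  have "a1 * f z * f y + a2 * f z * h y + c1 * h z * f y + c2 * h z * h y
      = a1 * f z * f y + b1 * f z * h y + a2 * h z * f y + b2 * h z * h y" for y z
    using swap(1)[of z y] unfolding a b c d by (simp add: algebra_simps)
  from lin_indep_pair_bilinearD[OF ind this]
  have e1: "a2 = b1" "c1 = a2" "c2 = b2"
    by simp_all
  have "b1 * f z * f y + b2 * f z * h y + d1 * h z * f y + d2 * h z * h y
      = c1 * f z * f y + d1 * f z * h y + c2 * h z * f y + d2 * h z * h y" for y z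
    using swap(2)[of z y] unfolding a b c d by (simp add: algebra_simps)
  from lin_indep_pair_bilinearD[OF ind this]
  have e2: "b2 = d1" by simp
  \<comment> \<open>Of the eight numbers, \<open>a1\<close>, \<open>b1\<close>, \<open>d1\<close>
    and \<open>d2\<close> are left; \<open>a2\<close> and \<open>c1\<close> equal \<open>b1\<close>,
    while \<open>b2\<close> and \<open>c2\<close> equal \<open>d1\<close>.\<close>
  note e = e1(1) e1(2)[unfolded e1(1)] e1(3)[unfolded e2] e2
  define A B C D where "A = a1" and "B = b1" and "C = d1" and "D = d2"
  note coeffs = A_def[symmetric] B_def[symmetric] C_def[symmetric] D_def[symmetric]
  have hm: "h (x * y) = g x * h y + h x * g y
      + B * f x * f y + C * (f x * h y + h x * f y) + D * h x * h y" for x y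
    using E[of x y] unfolding E_def c d e coeffs by (simp add: algebra_simps)
  have gm: "g (x * y) = g x * g y
      + A * f x * f y + B * (f x * h y + h x * f y) + C * h x * h y" for x y
    using \<Gamma>[of x y] unfolding \<Gamma>_def a b e coeffs by (simp add: algebra_simps)
  have fm: "f (x * y) = f x * g y + g x * f y + h x * h y" for x y
    using fgh unfolding cosine_sine_def by blast
  \<comment> \<open>The two bracketings of \<open>h (p * y * q)\<close> differ, up to sign, by
    \<open>A + D * B - C^2\<close> times \<open>f y\<close> times the minor at \<open>p\<close> and
    \<open>q\<close>, so points are chosen where the last two factors are nonzero.\<close>
  have "A = C^2 - D * B"
  proof -
    obtain p q where pq: "f p * h q - f q * h p \<noteq> 0"
      using lin_indep_pair_minor[OF ind] .
    then obtain y where y: "f y \<noteq> 0"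
      by force
    have "h ((p * y) * q) = h (p * (y * q))"
      by (simp add: mult.assoc)
    then have "(A + D * B - C^2) * f y * (f p * h q - f q * h p) = 0"
      unfolding hm[of "p * y" q] hm[of p "y * q"] hm[of p y] hm[of y q] gm[of p y] gm[of y q]
        fm[of p y] fm[of y q]
      by algebra
    with pq y have "A + D * B - C^2 = 0"
      by simp
    then show ?thesis
      by (simp add: algebra_simps)
  qed
  with gm hm show thesis
    using that by blast
qed

section \<open>The cubic and its multiplicative combinations\<close>

text \<open>The first three equations are Vieta's formulas for
  \<open>t^3 - D t^2 - 2 C t - B\<close>. The last clause fixes the naming: if any roots coincide,
  then \<open>p\<close> and \<open>q\<close> do.\<close>

lemma complex_cubic_roots:
  fixes B C D :: complex
  obtains p q r where "D = p + q + r" "C = - (p * q + p * r + q * r) / 2" "B = p * q * r"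
    "p = q \<or> p \<noteq> q \<and> p \<noteq> r \<and> q \<noteq> r"
proof -
  have "\<not> constant (poly [:- B, - 2 * C, - D, 1:])"
    by (simp add: constant_degree)
  then obtain r where r: "poly [:- B, - 2 * C, - D, 1:] r = 0"
    using fundamental_theorem_of_algebra by blast
  \<comment> \<open>Dividing the cubic by \<open>t - r\<close> leaves
    \<open>t^2 - (D - r) t + (r^2 - D r - 2 C)\<close>; \<open>s\<close> is a square root of its
    discriminant.\<close>
  define s where "s = csqrt ((D - r)^2 - 4 * (r^2 - D * r - 2 * C))"
  define p q where "p = (D - r + s) / 2" and "q = (D - r - s) / 2"
  have s2: "s^2 = (D - r)^2 - 4 * (r^2 - D * r - 2 * C)"
    by (simp add: s_def)
  have D: "D = p + q + r"
    by (simp add: p_def q_def field_simps)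
  have "4 * (p * q) = (D - r)^2 - s^2"
    by (simp add: p_def q_def field_simps power2_eq_square)
  then have pq: "p * q = r^2 - D * r - 2 * C"
    unfolding s2 by algebra
  have C: "C = - (p * q + p * r + q * r) / 2"
  proof -
    have "2 * C = - (p * q + p * r + q * r)"
      using pq unfolding D by algebra
    then show ?thesis
      by (simp add: field_simps)
  qed
  have B: "B = p * q * r"
    using r unfolding pq by (simp add: algebra_simps power2_eq_square)
  consider "p = q \<or> p \<noteq> q \<and> p \<noteq> r \<and> q \<noteq> r" | "p = r" | "q = r"
    by blast
  then show thesis
  proof cases
    case 1
    then show thesis using that D C B by blast
  next
    case 2
    show thesis using that[of p r q] D C B 2 by (simp add: algebra_simps)
  next
    case 3
    show thesis using that[of q r p] D C B 3 by (simp add: algebra_simps)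
  qed
qed

text \<open>The coefficient of \<open>f\<close> below is \<open>p^2 - D p - C\<close>, written in the roots of the cubic.\<close>

lemma multiplicative_fun_root:
  fixes f g h :: "'a::semigroup_mult \<Rightarrow> complex"
  assumes fgh: "cosine_sine f g h"
    and hm: "\<And>x y. h (x * y) = g x * h y + h x * g y
      + B * f x * f y + C * (f x * h y + h x * f y) + D * h x * h y"
    and gm: "\<And>x y. g (x * y) = g x * g y
      + (C^2 - D * B) * f x * f y + B * (f x * h y + h x * f y) + C * h x * h y"
    and DCB: "D = p + q + r" "C = - (p * q + p * r + q * r) / 2" "B = p * q * r"
  shows "multiplicative_fun (\<lambda>x. g x + (q * r - p * q - p * r) / 2 * f x + p * h x)"
  unfolding multiplicative_fun_def
proof (intro allI)
  fix x y
  have fm: "f (x * y) = f x * g y + g x * f y + h x * h y"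
    using fgh unfolding cosine_sine_def by blast
  show "g (x * y) + (q * r - p * q - p * r) / 2 * f (x * y) + p * h (x * y)
      = (g x + (q * r - p * q - p * r) / 2 * f x + p * h x)
      * (g y + (q * r - p * q - p * r) / 2 * f y + p * h y)"
    unfolding fm gm hm DCB by (simp add: field_simps power2_eq_square)
qed

section \<open>Verification of the four families\<close>

text \<open>On the diagonal the sine law gives \<open>2 * k * (\<mu> - \<chi>) * \<chi>\<close> and
  multiplicativity gives \<open>k * (\<mu>^2 - \<chi>^2)\<close>; these differ by
  \<open>k * (\<mu> - \<chi>)^2\<close>.\<close>

lemma sine_addition_not_difference:
  assumes "multiplicative_fun \<chi>" "multiplicative_fun \<mu>" "\<chi> \<noteq> \<mu>"
    and "sine_addition \<phi> \<chi>" and "\<And>x. \<phi> x = k * (\<mu> x - \<chi> x)"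
  shows "k = 0"
proof -
  obtain x where x: "\<mu> x - \<chi> x \<noteq> 0"
    using assms(3) by (force simp: fun_eq_iff)
  have "\<phi> (x * x) = 2 * \<phi> x * \<chi> x" "\<mu> (x * x) = \<mu> x * \<mu> x" "\<chi> (x * x) = \<chi> x * \<chi> x"
    using assms unfolding sine_addition_def multiplicative_fun_def by simp_all
  then have "k * (\<mu> x - \<chi> x)^2 = 0"
    unfolding assms(5) by algebra
  with x show ?thesis
    by simp
qed

text \<open>In families (2) and (3) both \<open>F\<close> and \<open>H\<close> are combinations of
  this pair, so their independence reduces to an invertible 2x2 matrix of coefficients.\<close>

lemma lin_indep_difference_sine:
  assumes "multiplicative_fun \<chi>" "multiplicative_fun \<mu>" "\<chi> \<noteq> \<mu>"
    and "sine_addition \<phi> \<chi>" and "\<phi> \<noteq> (\<lambda>x. 0)"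
  shows "lin_indep_pair (\<lambda>x. \<mu> x - \<chi> x) \<phi>"
  unfolding lin_indep_pair_iff
proof (intro allI impI)
  fix a b assume *: "\<forall>x. a * (\<mu> x - \<chi> x) + b * \<phi> x = 0"
  have "b = 0"
  proof (rule ccontr)
    assume b: "b \<noteq> 0"
    have eq: "\<phi> x = (- a / b) * (\<mu> x - \<chi> x)" for x
      using *[rule_format, of x] b by (simp add: field_simps add_eq_0_iff2 eq_neg_iff_add_eq_0)
    have "- a / b = 0"
      using sine_addition_not_difference[OF assms(1-4) eq] .
    then have "\<phi> = (\<lambda>x. 0)"
      unfolding fun_eq_iff eq by auto
    with assms(5) show False by simp
  qed
  moreover obtain x where "\<mu> x - \<chi> x \<noteq> 0"
    using assms(3) by (force simp: fun_eq_iff)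
  ultimately show "a = 0 \<and> b = 0"
    using * by force
qed

lemma family1_cosine_sine:
  assumes "family1 F G H"
  shows "cosine_sine F G H \<and> lin_indep_pair F H"
proof -
  have F: "F \<noteq> (\<lambda>x. 0)" and H: "H \<noteq> (\<lambda>x. 0)" and HG: "sine_addition H G"
    and FGH: "cosine_sine F G H"
    using assms unfolding family1_def by auto
  have "a = 0 \<and> b = 0" if *: "\<And>x. a * F x + b * H x = 0" for a b
  proof -
    obtain x where x: "H x \<noteq> 0"
      using H by auto
    have "H (x * x) = H x * G x + G x * H x" "F (x * x) = F x * G x + G x * F x + H x * H x"
      using HG FGH unfolding sine_addition_def cosine_sine_def by blast+
    \<comment> \<open>The relation at \<open>x * x\<close> is \<open>2 * G x\<close> times the
      relation at \<open>x\<close>, plus this term.\<close>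
    then have "a * (H x * H x) = 0"
      using *[of x] *[of "x * x"] by algebra
    with x have "a = 0" by simp
    with * x show ?thesis by force
  qed
  with FGH show ?thesis
    unfolding lin_indep_pair_iff by blast
qed

lemma family2_cosine_sine:
  assumes "family2 F G H"
  shows "cosine_sine F G H \<and> lin_indep_pair F H"
proof -
  obtain c \<chi> \<mu> \<phi> where c: "c \<noteq> 0" and fns: "multiplicative_fun \<chi>" "multiplicative_fun \<mu>" "\<chi> \<noteq> \<mu>"
      "sine_addition \<phi> \<chi>" "\<phi> \<noteq> (\<lambda>x. 0)"
    and FGH: "F = (\<lambda>x. c^2 * \<mu> x - c^2 * \<chi> x - c * \<phi> x)" "G = \<chi>" "H = (\<lambda>x. c * \<mu> x - c * \<chi> x)"
    using assms unfolding family2_def by blast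
  have "cosine_sine F G H"
    using fns(1,2,4) unfolding FGH cosine_sine_def multiplicative_fun_def sine_addition_def
    by (simp add: algebra_simps power2_eq_square)
  moreover have "a = 0 \<and> b = 0" if *: "\<And>x. a * F x + b * H x = 0" for a b
  proof -
    have "\<forall>x. (a * c^2 + b * c) * (\<mu> x - \<chi> x) + (- a * c) * \<phi> x = 0"
      using * unfolding FGH by (simp add: algebra_simps)
    then have "a * c^2 + b * c = 0 \<and> - a * c = 0"
      using lin_indep_difference_sine[OF fns] unfolding lin_indep_pair_iff by blast
    with c show ?thesis by auto
  qed
  ultimately show ?thesis
    unfolding lin_indep_pair_iff by blast
qed

lemma family3_cosine_sine:
  assumes "family3 F G H"
  shows "cosine_sine F G H \<and> lin_indep_pair F H"
proof -
  obtain c1 c2 \<chi> \<mu> \<phi> where c: "c1 \<noteq> 0" "1 + c1 * c2^2 = 0"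
    and fns: "multiplicative_fun \<chi>" "multiplicative_fun \<mu>" "\<chi> \<noteq> \<mu>"
      "sine_addition \<phi> \<chi>" "\<phi> \<noteq> (\<lambda>x. 0)"
    and FGH: "F = (\<lambda>x. - c1 * \<mu> x + c1 * \<chi> x - c1 * c2 * \<phi> x)"
      "G = (\<lambda>x. 1/2 * \<mu> x + 1/2 * \<chi> x - 1/2 * c2 * \<phi> x)" "H = \<phi>"
    using assms unfolding family3_def by blast
  have "cosine_sine F G H"
    unfolding cosine_sine_def
  proof (intro allI)
    fix x y
    have "\<phi> (x * y) = \<phi> x * \<chi> y + \<chi> x * \<phi> y" "\<mu> (x * y) = \<mu> x * \<mu> y" "\<chi> (x * y) = \<chi> x * \<chi> y"
      using fns unfolding multiplicative_fun_def sine_addition_def by blast+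
    note mult = this
    \<comment> \<open>The constraint on the constants removes the single term that the product laws
      leave over.\<close>
    have "F x * G y + G x * F y + H x * H y - F (x * y) = (1 + c1 * c2^2) * \<phi> x * \<phi> y"
      unfolding FGH mult by (simp add: field_simps power2_eq_square)
    then show "F (x * y) = F x * G y + G x * F y + H x * H y"
      unfolding c by simp
  qed
  moreover have "a = 0 \<and> b = 0" if *: "\<And>x. a * F x + b * H x = 0" for a b
  proof -
    have "\<forall>x. (- a * c1) * (\<mu> x - \<chi> x) + (b - a * c1 * c2) * \<phi> x = 0"
      using * unfolding FGH by (simp add: algebra_simps)
    then have "- a * c1 = 0 \<and> b - a * c1 * c2 = 0"
      using lin_indep_difference_sine[OF fns] unfolding lin_indep_pair_iff by blast
    with c show ?thesis by simp
  qed
  ultimately show ?thesis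
    unfolding lin_indep_pair_iff by blast
qed

text \<open>Any of the three functions may vanish identically, so they need not be independent themselves.\<close>

lemma multiplicative_fun_lin_indep_differences:
  assumes mult: "multiplicative_fun \<chi>\<^sub>1" "multiplicative_fun \<chi>\<^sub>2" "multiplicative_fun \<chi>\<^sub>3"
    and "\<chi>\<^sub>1 \<noteq> \<chi>\<^sub>2" "\<chi>\<^sub>1 \<noteq> \<chi>\<^sub>3" "\<chi>\<^sub>2 \<noteq> \<chi>\<^sub>3"
  shows "lin_indep_pair (\<lambda>x. \<chi>\<^sub>1 x - \<chi>\<^sub>3 x) (\<lambda>x. \<chi>\<^sub>2 x - \<chi>\<^sub>3 x)"
  unfolding lin_indep_pair_iff
proof (intro allI impI)
  fix a b assume *: "\<forall>x. a * (\<chi>\<^sub>1 x - \<chi>\<^sub>3 x) + b * (\<chi>\<^sub>2 x - \<chi>\<^sub>3 x) = 0"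
  have m: "\<chi>\<^sub>1 (x * y) = \<chi>\<^sub>1 x * \<chi>\<^sub>1 y" "\<chi>\<^sub>2 (x * y) = \<chi>\<^sub>2 x * \<chi>\<^sub>2 y" "\<chi>\<^sub>3 (x * y) = \<chi>\<^sub>3 x * \<chi>\<^sub>3 y"
    for x y
    using mult unfolding multiplicative_fun_def by blast+
  obtain y where y: "\<chi>\<^sub>1 y - \<chi>\<^sub>2 y \<noteq> 0"
    using assms(4) by (force simp: fun_eq_iff)
  obtain x where x: "\<chi>\<^sub>1 x - \<chi>\<^sub>3 x \<noteq> 0"
    using assms(5) by (force simp: fun_eq_iff)
  obtain z where z: "\<chi>\<^sub>2 z - \<chi>\<^sub>3 z \<noteq> 0"
    using assms(6) by (force simp: fun_eq_iff)
  \<comment> \<open>If R denotes the left side of the relation, this product is R(x y) -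
    \<open>\<chi>\<^sub>2 y\<close> R(x) - \<open>\<chi>\<^sub>3 x\<close> R(y).\<close>
  have "a * (\<chi>\<^sub>1 x - \<chi>\<^sub>3 x) * (\<chi>\<^sub>1 y - \<chi>\<^sub>2 y) = 0"
    using *[rule_format, of x] *[rule_format, of y] *[rule_format, of "x * y"]
    unfolding m by algebra
  with x y have "a = 0" by simp
  with * z show "a = 0 \<and> b = 0" by force
qed

text \<open>The defect of the equation is a multiple of one product of differences, and the
  constraint makes its coefficient vanish. The coefficients of \<open>F\<close> sum to zero, as do
  those of \<open>H\<close>, so both are combinations of the independent differences from
  \<open>\<chi>\<^sub>3\<close>.\<close>

lemma family4_cosine_sine:
  assumes "family4 F G H"
  shows "cosine_sine F G H \<and> lin_indep_pair F H"
proof -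
  obtain l r c \<chi>\<^sub>1 \<chi>\<^sub>2 \<chi>\<^sub>3 where nz: "l \<noteq> 0" "r \<noteq> 0" "c \<noteq> 0" "2 * c * l^2 * r * (2 - r) = 1"
    and fns: "multiplicative_fun \<chi>\<^sub>1" "multiplicative_fun \<chi>\<^sub>2" "multiplicative_fun \<chi>\<^sub>3"
      "\<chi>\<^sub>1 \<noteq> \<chi>\<^sub>2" "\<chi>\<^sub>1 \<noteq> \<chi>\<^sub>3" "\<chi>\<^sub>2 \<noteq> \<chi>\<^sub>3"
    and FGH: "F = (\<lambda>x. c * r * \<chi>\<^sub>1 x + c * (2 - r) * \<chi>\<^sub>2 x - 2 * c * \<chi>\<^sub>3 x)"
      "G = (\<lambda>x. 1/4 * r * \<chi>\<^sub>1 x + 1/4 * (2 - r) * \<chi>\<^sub>2 x + 1/2 * \<chi>\<^sub>3 x)"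
      "H = (\<lambda>x. 1 / (2 * l) * \<chi>\<^sub>1 x - 1 / (2 * l) * \<chi>\<^sub>2 x)"
    using assms unfolding family4_def by blast
  define k where "k = 1 / (2 * l)"
  have k: "k \<noteq> 0" "2 * k^2 = c * r * (2 - r)"
  proof -
    show "k \<noteq> 0" using nz by (simp add: k_def)
    have "2 * k^2 = (2 * c * l^2 * r * (2 - r)) * (2 * k^2)"
      unfolding nz(4) by simp
    also have "\<dots> = c * r * (2 - r)"
      using nz(1) by (simp add: k_def field_simps power2_eq_square)
    finally show "2 * k^2 = c * r * (2 - r)" .
  qed
  have "cosine_sine F G H"
    unfolding cosine_sine_def
  proof (intro allI)
    fix x y
    have mult: "\<chi>\<^sub>1 (x * y) = \<chi>\<^sub>1 x * \<chi>\<^sub>1 y" "\<chi>\<^sub>2 (x * y) = \<chi>\<^sub>2 x * \<chi>\<^sub>2 y"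
      "\<chi>\<^sub>3 (x * y) = \<chi>\<^sub>3 x * \<chi>\<^sub>3 y"
      using fns unfolding multiplicative_fun_def by blast+
    have "2 * (F x * G y + G x * F y + H x * H y - F (x * y))
        = (2 * k^2 - c * r * (2 - r)) * (\<chi>\<^sub>1 x - \<chi>\<^sub>2 x) * (\<chi>\<^sub>1 y - \<chi>\<^sub>2 y)"
      unfolding FGH mult k_def[symmetric] by (simp add: field_simps power2_eq_square)
    then show "F (x * y) = F x * G y + G x * F y + H x * H y"
      unfolding k by algebra
  qed
  moreover have "a = 0 \<and> b = 0" if *: "\<And>x. a * F x + b * H x = 0" for a b
  proof -
    have "\<forall>x. (a * c * r + b * k) * (\<chi>\<^sub>1 x - \<chi>\<^sub>3 x) + (a * c * (2 - r) - b * k) * (\<chi>\<^sub>2 x - \<chi>\<^sub>3 x) = 0"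
      using * unfolding FGH k_def[symmetric] by (simp add: algebra_simps)
    then have ab: "a * c * r + b * k = 0" "a * c * (2 - r) - b * k = 0"
      using multiplicative_fun_lin_indep_differences[OF fns] unfolding lin_indep_pair_iff by blast+
    then have "2 * (a * c) = 0"
      by algebra
    with nz have "a = 0" by simp
    with ab k show ?thesis by simp
  qed
  ultimately show ?thesis
    unfolding lin_indep_pair_iff by blast
qed

section \<open>From a solution to one of the families\<close>

lemma cosine_sine_families:
  fixes f g h :: "'a::semigroup_mult \<Rightarrow> complex"
  assumes fgh: "cosine_sine f g h" and ind: "lin_indep_pair f h"
  obtains \<delta> G H where
    "g = (\<lambda>x. - (\<delta>^2 / 2) * f x + G x + \<delta> * H x)" "h = (\<lambda>x. - \<delta> * f x + H x)"
    "family1 f G H \<or> family2 f G H \<or> family4 f G H"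
proof -
  obtain B C D where
    hm: "\<And>x y. h (x * y) = g x * h y + h x * g y
      + B * f x * f y + C * (f x * h y + h x * f y) + D * h x * h y" and
    gm: "\<And>x y. g (x * y) = g x * g y
      + (C^2 - D * B) * f x * f y + B * (f x * h y + h x * f y) + C * h x * h y"
    by (rule cosine_sine_quadratic[OF fgh ind]) (rule that)
  obtain p q r where roots: "D = p + q + r" "C = - (p * q + p * r + q * r) / 2" "B = p * q * r"
    "p = q \<or> p \<noteq> q \<and> p \<noteq> r \<and> q \<noteq> r"
    using complex_cubic_roots .
  note root = multiplicative_fun_root[OF fgh hm gm]
  have fm: "f (x * y) = f x * g y + g x * f y + h x * h y" for x y
    using fgh unfolding cosine_sine_def by blast
  have not_zero: "(\<lambda>x. a * f x + h x) \<noteq> (\<lambda>x. 0)" for a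
    using ind unfolding lin_indep_pair_iff fun_eq_iff by (metis mult_1 zero_neq_one)
  define \<chi> where "\<chi> = (\<lambda>t s x. g x + t * h x + s * f x)"
  have \<chi>_neq: "\<chi> t s \<noteq> \<chi> t' s'" if "t \<noteq> t'" for t s t' s'
  proof
    assume "\<chi> t s = \<chi> t' s'"
    then have "s * f x + t * h x = s' * f x + t' * h x" for x
      by (auto simp: \<chi>_def fun_eq_iff algebra_simps)
    with lin_indep_pairD(2)[OF ind this] that show False
      by simp
  qed
  define sp where "sp = (q * r - p * q - p * r) / 2"
  define sq where "sq = (p * r - p * q - q * r) / 2"
  define sr where "sr = (p * q - p * r - q * r) / 2"
  have \<chi>p: "multiplicative_fun (\<chi> p sp)"
    using root[of p q r] roots(1-3) by (simp add: \<chi>_def sp_def algebra_simps)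
  have \<chi>q: "multiplicative_fun (\<chi> q sq)"
    using root[of q p r] roots(1-3) by (simp add: \<chi>_def sq_def algebra_simps)
  have \<chi>r: "multiplicative_fun (\<chi> r sr)"
    using root[of r p q] roots(1-3) by (simp add: \<chi>_def sr_def algebra_simps)
  \<comment> \<open>Solving the substitution with \<delta> = -\<open>t\<close> gives
    \<open>H = h - t f\<close> and \<open>G = g + t h - (t^2 / 2) f\<close>, so
    \<open>shift t\<close> says that this choice of \<delta> succeeds.\<close>
  define shift where "shift = (\<lambda>t. family1 f (\<chi> t (- (t^2) / 2)) (\<lambda>x. h x - t * f x)
    \<or> family2 f (\<chi> t (- (t^2) / 2)) (\<lambda>x. h x - t * f x)
    \<or> family4 f (\<chi> t (- (t^2) / 2)) (\<lambda>x. h x - t * f x))"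
  have "shift p \<or> shift r"
  proof (cases "p = q")
    case True
    \<comment> \<open>At a double root the coefficient \<open>sp\<close> is exactly the one that the
      shift by \<open>p\<close> produces, so \<open>G\<close> is itself multiplicative, as families
      (1) and (2) demand.\<close>
    have \<chi>p': "\<chi> p sp = \<chi> p (- (p^2) / 2)"
      by (simp add: sp_def True power2_eq_square)
    \<comment> \<open>The sine function at the double root \<open>p\<close> involves the remaining
      root \<open>r\<close>. When \<open>r = p\<close> it coincides with \<open>H\<close>, so one
      computation serves both families.\<close>
    let ?\<chi> = "\<chi> p (- (p^2) / 2)" and ?\<phi> = "\<lambda>x. - r * f x + h x"
    have sine: "sine_addition ?\<phi> ?\<chi>"
      unfolding sine_addition_def \<chi>_def hm fm roots(1-3) True
      by (simp add: field_simps power2_eq_square)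
    show ?thesis
    proof (cases "p = r")
      case True
      have "cosine_sine f ?\<chi> (\<lambda>x. - r * f x + h x)"
        unfolding cosine_sine_def fm \<chi>_def True by (simp add: field_simps power2_eq_square)
      moreover have "f \<noteq> (\<lambda>x. 0)"
        using ind unfolding lin_indep_pair_iff fun_eq_iff
        by (metis add_0_right mult_zero_left mult_zero_right zero_neq_one)
      moreover have "(\<lambda>x. h x - p * f x) = ?\<phi>"
        by (simp add: True)
      ultimately have "family1 f ?\<chi> (\<lambda>x. h x - p * f x)"
        using \<chi>p sine not_zero unfolding family1_def \<chi>p' by metis
      then show ?thesis
        unfolding shift_def by blast
    next
      case False
      \<comment> \<open>Since \<open>\<chi> r sr - ?\<chi>\<close> equals
        \<open>(r - p) * (h - p * f)\<close>, this value is forced by the form of \<open>H\<close>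
        in family (2).\<close>
      define c where "c = 1 / (r - p)"
      have c: "c \<noteq> 0" "c * (r - p) = 1"
        using False by (simp_all add: c_def)
      have diff: "\<chi> r sr x - ?\<chi> x = (r - p) * (h x - p * f x)" for x
        by (simp add: \<chi>_def sr_def \<open>p = q\<close> field_simps power2_eq_square)
      have H: "(\<lambda>x. h x - p * f x) = (\<lambda>x. c * \<chi> r sr x - c * ?\<chi> x)"
        unfolding right_diff_distrib[symmetric] diff using c
        by (simp add: mult.assoc[symmetric])
      have F: "f = (\<lambda>x. c^2 * \<chi> r sr x - c^2 * ?\<chi> x - c * ?\<phi> x)"
      proof
        fix x
        have "c^2 * \<chi> r sr x - c^2 * ?\<chi> x - c * ?\<phi> x
            = c * (c * (r - p)) * (h x - p * f x) - c * ?\<phi> x"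
          unfolding right_diff_distrib[symmetric] diff by (simp add: power2_eq_square)
        also have "\<dots> = c * (r - p) * f x"
          using c(2) by algebra
        finally show "f x = c^2 * \<chi> r sr x - c^2 * ?\<chi> x - c * ?\<phi> x"
          unfolding c by simp
      qed
      have "family2 f ?\<chi> (\<lambda>x. h x - p * f x)"
        unfolding family2_def
        by (rule exI[of _ c], rule exI[of _ ?\<chi>], rule exI[of _ "\<chi> r sr"], rule exI[of _ ?\<phi>])
          (use c \<chi>p[unfolded \<chi>p'] \<chi>r \<chi>_neq[OF False] not_zero sine F H in blast)
      then show ?thesis
        unfolding shift_def by blast
    qed
  next
    case False
    then have ne: "p - q \<noteq> 0" "p - r \<noteq> 0" "q - r \<noteq> 0"
      using roots(4) by auto
    \<comment> \<open>The difference \<open>\<chi> p sp - \<chi> q sq\<close> is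
      \<open>(p - q) * (h - r * f)\<close>, which dictates the shift by \<open>r\<close> and the
      value of \<open>l\<close>. In the formula for \<open>F\<close>, \<rho> makes \<open>h\<close>
      cancel and \<open>c\<close> normalises the coefficient of \<open>f\<close> to 1.\<close>
    define l \<rho> c where "l = (p - q) / 2" and "\<rho> = 2 * (r - q) / (p - q)"
      and "c = - 1 / (2 * (p - r) * (q - r))"
    have \<rho>: "2 - \<rho> = 2 * (p - r) / (p - q)"
      using ne by (simp add: \<rho>_def field_simps)
    have nz: "l \<noteq> 0" "\<rho> \<noteq> 0" "c \<noteq> 0"
      using ne by (auto simp: l_def \<rho>_def c_def)
    have "2 * c * l^2 * \<rho> * (2 - \<rho>) = 1"
      unfolding \<rho> unfolding l_def \<rho>_def c_def using ne
      by (simp add: divide_simps) (simp add: algebra_simps power2_eq_square)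
    moreover have "f x = c * \<rho> * \<chi> p sp x + c * (2 - \<rho>) * \<chi> q sq x - 2 * c * \<chi> r sr x" for x
      unfolding \<rho> unfolding \<rho>_def c_def \<chi>_def sp_def sq_def sr_def using ne
      by (simp add: divide_simps) (simp add: algebra_simps power2_eq_square)
    moreover have "\<chi> r (- (r^2) / 2) x
        = 1/4 * \<rho> * \<chi> p sp x + 1/4 * (2 - \<rho>) * \<chi> q sq x + 1/2 * \<chi> r sr x" for x
      unfolding \<rho> unfolding \<rho>_def \<chi>_def sp_def sq_def sr_def using ne
      by (simp add: divide_simps) (simp add: algebra_simps power2_eq_square)
    moreover have "h x - r * f x = 1 / (2 * l) * \<chi> p sp x - 1 / (2 * l) * \<chi> q sq x" for x
      unfolding l_def \<chi>_def sp_def sq_def using ne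
      by (simp add: divide_simps) (simp add: algebra_simps power2_eq_square)
    ultimately have "family4 f (\<chi> r (- (r^2) / 2)) (\<lambda>x. h x - r * f x)"
      unfolding family4_def using nz \<chi>p \<chi>q \<chi>r \<chi>_neq ne unfolding fun_eq_iff[of f]
      by (intro exI[of _ l] exI[of _ \<rho>] exI[of _ c] exI[of _ "\<chi> p sp"] exI[of _ "\<chi> q sq"]
          exI[of _ "\<chi> r sr"]) auto
    then show ?thesis
      unfolding shift_def by blast
  qed
  then obtain t where "shift t"
    by blast
  moreover have "g = (\<lambda>x. - ((- t)^2 / 2) * f x + \<chi> t (- (t^2) / 2) x + (- t) * (h x - t * f x))"
    by (simp add: \<chi>_def fun_eq_iff field_simps power2_eq_square)
  moreover have "h = (\<lambda>x. - (- t) * f x + (h x - t * f x))"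
    by simp
  ultimately show thesis
    using that[of "- t" "\<chi> t (- (t^2) / 2)" "\<lambda>x. h x - t * f x"]
    unfolding shift_def by blast
qed

theorem theorem4p2:
  fixes f g h :: "'a::semigroup_mult \<Rightarrow> complex"
  shows "cosine_sine f g h \<and> lin_indep_pair f h \<longleftrightarrow>
    (\<exists>(\<delta>::complex) F G H.
       f = F \<and>
       g = (\<lambda>x. - (\<delta>^2 / 2) * F x + G x + \<delta> * H x) \<and>
       h = (\<lambda>x. - \<delta> * F x + H x) \<and>
       (family1 F G H \<or> family2 F G H \<or> family3 F G H \<or> family4 F G H))"
    (is "?L \<longleftrightarrow> ?R")
proof
  assume ?L
  then obtain \<delta> G H where
    "g = (\<lambda>x. - (\<delta>^2 / 2) * f x + G x + \<delta> * H x)" "h = (\<lambda>x. - \<delta> * f x + H x)"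
    "family1 f G H \<or> family2 f G H \<or> family4 f G H"
    using cosine_sine_families by blast
  then show ?R
    by blast
next
  assume ?R
  then obtain \<delta> F G H where
    eqs: "f = F" "g = (\<lambda>x. - (\<delta>^2 / 2) * F x + G x + \<delta> * H x)" "h = (\<lambda>x. - \<delta> * F x + H x)"
    and "family1 F G H \<or> family2 F G H \<or> family3 F G H \<or> family4 F G H"
    by blast
  then have "cosine_sine F G H \<and> lin_indep_pair F H"
    using family1_cosine_sine family2_cosine_sine family3_cosine_sine family4_cosine_sine by blast
  then show ?L
    unfolding eqs cosine_sine_shift using lin_indep_pair_shift by blast
qed

end
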